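(* Let $a$ be a real number with $a\le -2$, and let $\mathcal{O}_{\mathbb{R}}(a+1,2a+1,3a+1)$ be the corresponding generalized octonion algebra. Then in this algebra all Fibonacci octonions $F_n$ ($n\in\mathbb{N}$, $n\ge 0$) are invertible elements.
   Context: The Fibonacci sequence $(f_n)_{n\ge 0}$ is defined by $f_0=0$, $f_1=1$, $f_n=f_{n-1}+f_{n-2}$ for $n\ge 2$. For real $\alpha,\beta,\gamma$, the generalized octonion algebra $\mathcal{O}_{\mathbb{R}}(\alpha,\beta,\gamma)$ is the 8-dimensional real algebra with basis $\{1,e_1,\dots,e_7\}$, where $1$ is the identity, with squares $e_1^2=-\alpha$, $e_2^2=-\beta$, $e_3^2=-\alpha\beta$, $e_4^2=-\gamma$, $e_5^2=-\alpha\gamma$, $e_6^2=-\beta\gamma$, $e_7^2=-\alpha\beta\gamma$, with $e_ie_j=-e_je_i$ for $i\ne j$, and with $e_1e_2=e_3$, $e_1e_3=-\alpha e_2$, $e_1e_4=e_5$, $e_1e_5=-\alpha e_4$, $e_1e_6=-e_7$, $e_1e_7=\alpha e_6$, $e_2e_3=\beta e_1$, $e_2e_4=e_6$, $e_2e_5=e_7$, $e_2e_6=-\beta e_4$, $e_2e_7=-\beta e_5$, $e_3e_4=e_7$, $e_3e_5=-\alpha e_6$, $e_3e_6=\beta e_5$, $e_3e_7=-\alpha\beta e_4$, $e_4e_5=\gamma e_1$, $e_4e_6=\gamma e_2$, $e_4e_7=\gamma e_3$, $e_5e_6=-\gamma e_3$, $e_5e_7=\alpha\gamma e_2$, $e_6e_7=-\beta\gamma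 e_1$. For $x=x_0+x_1e_1+\dots+x_7e_7$ with $x_i \in \mathbb{R}$, the conjugate is $\overline{x}=x_0-x_1e_1-\dots-x_7e_7$ and the norm is $n(x)=x\overline{x}=x_0^2+\alpha x_1^2+\beta x_2^2+\alpha\beta x_3^2+\gamma x_4^2+\alpha\gamma x_5^2+\beta\gamma x_6^2+\alpha\beta\gamma x_7^2\in\mathbb{R}$. An element $x$ is invertible if there is $y$ in the algebra with $xy=yx=1$; this is equivalent to $n(x)\ne 0$. The $n$-th Fibonacci octonion ($n\ge 0$) is $F_n=f_n+f_{n+1}e_1+f_{n+2}e_2+f_{n+3}e_3+f_{n+4}e_4+f_{n+5}e_5+f_{n+6}e_6+f_{n+7}e_7$. *)

theory Defs
  imports "HOL-Analysis.Analysis" "HOL-Number_Theory.Fib"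
begin

text \<open>
  The underlying real vector space of the generalized octonion algebra with parameters
  \<open>\<alpha>, \<beta>, \<gamma>\<close> is \<open>real ^ 8\<close>, with coordinates indexed by the elements \<open>0, \<dots>, 7\<close> of
  the index type \<open>8\<close>.  The basis vector \<open>oct_e 0\<close> is the identity \<open>1\<close> of the algebra.
  The componentwise product that the library puts on \<open>real ^ 8\<close> plays no role.
\<close>

definition oct_e :: "nat \<Rightarrow> real ^ 8" where
  "oct_e k = axis (of_nat k) 1"

text \<open>Row \<open>i\<close>, column \<open>j\<close> (counted from \<open>0\<close>) is the product of \<open>oct_e i\<close> and \<open>oct_e j\<close>.\<close>

definition oct_table :: "real \<Rightarrow> real \<Rightarrow> real \<Rightarrow> (real ^ 8) list list" where
  "oct_table \<alpha> \<beta> \<gamma> = (let e = oct_e in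
    [[e 0, e 1, e 2, e 3, e 4, e 5, e 6, e 7],
     [e 1, (-\<alpha>) *\<^sub>R e 0, e 3, (-\<alpha>) *\<^sub>R e 2, e 5, (-\<alpha>) *\<^sub>R e 4, - e 7, \<alpha> *\<^sub>R e 6],
     [e 2, - e 3, (-\<beta>) *\<^sub>R e 0, \<beta> *\<^sub>R e 1, e 6, e 7, (-\<beta>) *\<^sub>R e 4, (-\<beta>) *\<^sub>R e 5],
     [e 3, \<alpha> *\<^sub>R e 2, (-\<beta>) *\<^sub>R e 1, (-(\<alpha>*\<beta>)) *\<^sub>R e 0,
        e 7, (-\<alpha>) *\<^sub>R e 6, \<beta> *\<^sub>R e 5, (-(\<alpha>*\<beta>)) *\<^sub>R e 4],
     [e 4, - e 5, - e 6, - e 7, (-\<gamma>) *\<^sub>R e 0, \<gamma> *\<^sub>R e 1, \<gamma> *\<^sub>R e 2, \<gamma> *\<^sub>R e 3],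
     [e 5, \<alpha> *\<^sub>R e 4, - e 7, \<alpha> *\<^sub>R e 6,
        (-\<gamma>) *\<^sub>R e 1, (-(\<alpha>*\<gamma>)) *\<^sub>R e 0, (-\<gamma>) *\<^sub>R e 3, (\<alpha>*\<gamma>) *\<^sub>R e 2],
     [e 6, e 7, \<beta> *\<^sub>R e 4, (-\<beta>) *\<^sub>R e 5,
        (-\<gamma>) *\<^sub>R e 2, \<gamma> *\<^sub>R e 3, (-(\<beta>*\<gamma>)) *\<^sub>R e 0, (-(\<beta>*\<gamma>)) *\<^sub>R e 1],
     [e 7, (-\<alpha>) *\<^sub>R e 6, \<beta> *\<^sub>R e 5, (\<alpha>*\<beta>) *\<^sub>R e 4,
        (-\<gamma>) *\<^sub>R e 3, (-(\<alpha>*\<gamma>)) *\<^sub>R e 2, (\<beta>*\<gamma>) *\<^sub>R e 1, (-(\<alpha>*\<beta>*\<gamma>)) *\<^sub>R e 0]])"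

definition oct_mult :: "real \<Rightarrow> real \<Rightarrow> real \<Rightarrow> real ^ 8 \<Rightarrow> real ^ 8 \<Rightarrow> real ^ 8" where
  "oct_mult \<alpha> \<beta> \<gamma> x y =
    (\<Sum>i<8. \<Sum>j<8. (x $ of_nat i * y $ of_nat j) *\<^sub>R (oct_table \<alpha> \<beta> \<gamma> ! i ! j))"

definition oct_invertible :: "real \<Rightarrow> real \<Rightarrow> real \<Rightarrow> real ^ 8 \<Rightarrow> bool" where
  "oct_invertible \<alpha> \<beta> \<gamma> x \<longleftrightarrow>
    (\<exists>y. oct_mult \<alpha> \<beta> \<gamma> x y = oct_e 0 \<and> oct_mult \<alpha> \<beta> \<gamma> y x = oct_e 0)"

definition fib_oct :: "nat \<Rightarrow> real ^ 8" where
  "fib_oct n = (\<Sum>k<8. real (fib (n + k)) *\<^sub>R oct_e k)"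

text \<open>Consistency of the multiplication with the defining relations, the identity and the norm.\<close>

lemma lessThan_8: "{..<8::nat} = {0, 1, 2, 3, 4, 5, 6, 7}"
  by auto

lemma all_less_8:
  "(\<forall>i<8::nat. P i) \<longleftrightarrow> P 0 \<and> P 1 \<and> P 2 \<and> P 3 \<and> P 4 \<and> P 5 \<and> P 6 \<and> P 7"
proof -
  have "(\<forall>i<8::nat. P i) \<longleftrightarrow> (\<forall>i\<in>{..<8}. P i)" by auto
  then show ?thesis by (simp add: lessThan_8)
qed

lemma oct_e_nth: "i < 8 \<Longrightarrow> j < 8 \<Longrightarrow> oct_e i $ of_nat j = (if i = j then 1 else 0)"
proof -
  have "\<forall>i<8. \<forall>j<8. oct_e i $ of_nat j = (if i = j then 1 else 0)"
    unfolding all_less_8 by (simp add: oct_e_def axis_def)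
  then show "i < 8 \<Longrightarrow> j < 8 \<Longrightarrow> ?thesis" by blast
qed

lemma oct_mult_e:
  assumes "i < 8" "j < 8"
  shows "oct_mult \<alpha> \<beta> \<gamma> (oct_e i) (oct_e j) = oct_table \<alpha> \<beta> \<gamma> ! i ! j"
proof -
  have "oct_mult \<alpha> \<beta> \<gamma> (oct_e i) (oct_e j) =
      (\<Sum>k<8. \<Sum>l<8. if l = j then if k = i then oct_table \<alpha> \<beta> \<gamma> ! k ! l else 0 else 0)"
    unfolding oct_mult_def
    by (intro sum.cong refl) (auto simp: oct_e_nth assms)
  also have "\<dots> = oct_table \<alpha> \<beta> \<gamma> ! i ! j"
    using assms by (simp add: sum.delta)
  finally show ?thesis .
qed

lemma oct_table_anticommute:
  "\<forall>i<8. \<forall>j<8. 0 < i \<longrightarrow> 0 < j \<longrightarrow> i \<noteq> j \<longrightarrow>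
     oct_table \<alpha> \<beta> \<gamma> ! i ! j = - (oct_table \<alpha> \<beta> \<gamma> ! j ! i)"
  unfolding all_less_8 by (simp add: oct_table_def)

lemma UNIV_8: "(UNIV :: 8 set) = {0, 1, 2, 3, 4, 5, 6, 7}"
proof (rule sym, rule card_subset_eq)
  show "card {0, 1, 2, 3, 4, 5, 6, 7 :: 8} = card (UNIV :: 8 set)" by simp
qed auto

lemma forall_8: "(\<forall>i::8. P i) \<longleftrightarrow> P 0 \<and> P 1 \<and> P 2 \<and> P 3 \<and> P 4 \<and> P 5 \<and> P 6 \<and> P 7"
proof -
  have "(\<forall>i::8. P i) \<longleftrightarrow> (\<forall>i\<in>UNIV. P i)" by simp
  then show ?thesis unfolding UNIV_8 by simp
qed

lemma oct_mult_1_left: "oct_mult \<alpha> \<beta> \<gamma> (oct_e 0) x = x"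
  by (simp add: vec_eq_iff forall_8 oct_mult_def lessThan_8 oct_table_def oct_e_def axis_def)

lemma oct_mult_1_right: "oct_mult \<alpha> \<beta> \<gamma> x (oct_e 0) = x"
  by (simp add: vec_eq_iff forall_8 oct_mult_def lessThan_8 oct_table_def oct_e_def axis_def)

definition oct_cnj :: "real ^ 8 \<Rightarrow> real ^ 8" where
  "oct_cnj x = (\<chi> i. if i = 0 then x $ i else - (x $ i))"

lemma oct_mult_cnj:
  "oct_mult \<alpha> \<beta> \<gamma> x (oct_cnj x) =
    ((x $ 0)\<^sup>2 + \<alpha> * (x $ 1)\<^sup>2 + \<beta> * (x $ 2)\<^sup>2 + \<alpha> * \<beta> * (x $ 3)\<^sup>2
      + \<gamma> * (x $ 4)\<^sup>2 + \<alpha> * \<gamma> * (x $ 5)\<^sup>2 + \<beta> * \<gamma> * (x $ 6)\<^sup>2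
      + \<alpha> * \<beta> * \<gamma> * (x $ 7)\<^sup>2) *\<^sub>R oct_e 0"
  by (simp add: vec_eq_iff forall_8 oct_mult_def lessThan_8 oct_table_def oct_e_def axis_def
      oct_cnj_def power2_eq_square algebra_simps)

end

theory Submission
  imports Defs
begin

text \<open>
  As \<open>x \<cdot> cnj x = cnj x \<cdot> x = n(x)\<close> is a real number, \<open>x\<close> is invertible as soon as
  \<open>n(x) \<noteq> 0\<close> (\<open>oct_invertible_if_norm_nonzero\<close>).  For \<open>a \<le> -2\<close> the parameters \<open>a + 1\<close>,
  \<open>2 * a + 1\<close> and \<open>3 * a + 1\<close> are all at most \<open>-1\<close>, and this alone makes the norm of a
  Fibonacci octonion negative.  Write the parameters as \<open>-A, -B, -C\<close> with \<open>A, B, C \<ge> 1\<close>.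
  The positive terms of the norm are \<open>x\<^sub>0\<^sup>2\<close>, \<open>A B x\<^sub>3\<^sup>2\<close>, \<open>A C x\<^sub>5\<^sup>2\<close> and \<open>B C x\<^sub>6\<^sup>2\<close>.  Since
  \<open>A, B, C \<ge> 1\<close>, monotonicity of the Fibonacci numbers bounds the first three by \<open>A B C x\<^sub>5\<^sup>2\<close> each and the last by
  \<open>A B C x\<^sub>6\<^sup>2\<close>, while \<open>x\<^sub>7 = x\<^sub>5 + x\<^sub>6\<close> and \<open>x\<^sub>6 \<ge> x\<^sub>5\<close> give \<open>x\<^sub>7\<^sup>2 \<ge> x\<^sub>6\<^sup>2 + 3 x\<^sub>5\<^sup>2\<close>.  So the single
  negative term \<open>- A B C x\<^sub>7\<^sup>2\<close> outweighs all of them, and \<open>- A x\<^sub>1\<^sup>2 < 0\<close> makes the sum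
  strictly negative (\<open>oct_norm_fib_oct_neg\<close>).
\<close>

definition oct_norm :: "real \<Rightarrow> real \<Rightarrow> real \<Rightarrow> real ^ 8 \<Rightarrow> real" where
  "oct_norm \<alpha> \<beta> \<gamma> x =
    (x $ 0)\<^sup>2 + \<alpha> * (x $ 1)\<^sup>2 + \<beta> * (x $ 2)\<^sup>2 + \<alpha> * \<beta> * (x $ 3)\<^sup>2
      + \<gamma> * (x $ 4)\<^sup>2 + \<alpha> * \<gamma> * (x $ 5)\<^sup>2 + \<beta> * \<gamma> * (x $ 6)\<^sup>2
      + \<alpha> * \<beta> * \<gamma> * (x $ 7)\<^sup>2"

lemma oct_mult_cnj_right: "oct_mult \<alpha> \<beta> \<gamma> x (oct_cnj x) = oct_norm \<alpha> \<beta> \<gamma> x *\<^sub>R oct_e 0"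
  unfolding oct_norm_def by (rule oct_mult_cnj)

text \<open>Conjugation is an involution that preserves the norm, so this is the previous identity
  for the conjugate.\<close>

lemma oct_mult_cnj_left: "oct_mult \<alpha> \<beta> \<gamma> (oct_cnj x) x = oct_norm \<alpha> \<beta> \<gamma> x *\<^sub>R oct_e 0"
proof -
  have "oct_cnj (oct_cnj x) = x"
    by (simp add: oct_cnj_def vec_eq_iff)
  moreover have "oct_norm \<alpha> \<beta> \<gamma> (oct_cnj x) = oct_norm \<alpha> \<beta> \<gamma> x"
    by (simp add: oct_norm_def oct_cnj_def)
  ultimately show ?thesis
    using oct_mult_cnj_right[of \<alpha> \<beta> \<gamma> "oct_cnj x"] by simp
qed

lemma oct_mult_scaleR_right: "oct_mult \<alpha> \<beta> \<gamma> x (c *\<^sub>R y) = c *\<^sub>R oct_mult \<alpha> \<beta> \<gamma> x y"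
  by (simp add: oct_mult_def scaleR_sum_right mult.left_commute)

lemma oct_mult_scaleR_left: "oct_mult \<alpha> \<beta> \<gamma> (c *\<^sub>R x) y = c *\<^sub>R oct_mult \<alpha> \<beta> \<gamma> x y"
  by (simp add: oct_mult_def scaleR_sum_right mult.assoc)

lemma oct_invertible_if_norm_nonzero:
  assumes "oct_norm \<alpha> \<beta> \<gamma> x \<noteq> 0"
  shows "oct_invertible \<alpha> \<beta> \<gamma> x"
  unfolding oct_invertible_def
proof (intro exI conjI)
  let ?y = "inverse (oct_norm \<alpha> \<beta> \<gamma> x) *\<^sub>R oct_cnj x"
  show "oct_mult \<alpha> \<beta> \<gamma> x ?y = oct_e 0"
    using assms by (simp add: oct_mult_scaleR_right oct_mult_cnj_right)
  show "oct_mult \<alpha> \<beta> \<gamma> ?y x = oct_e 0"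
    using assms by (simp add: oct_mult_scaleR_left oct_mult_cnj_left)
qed

lemma fib_oct_nth:
  assumes "k < 8"
  shows "fib_oct n $ of_nat k = real (fib (n + k))"
proof -
  have "fib_oct n $ of_nat k = (\<Sum>i<8. if i = k then real (fib (n + i)) else 0)"
    unfolding fib_oct_def sum_component
    by (intro sum.cong refl) (simp add: oct_e_nth assms)
  then show ?thesis
    using assms by (simp add: sum.delta)
qed

text \<open>With \<open>x\<^sub>7 = x\<^sub>5 + x\<^sub>6\<close>, the left side collects the positive terms of the norm.  Each of
  them is charged to a separate summand of \<open>A * B * C * (x\<^sub>5\<^sup>2 + x\<^sub>5\<^sup>2 + x\<^sub>5\<^sup>2 + x\<^sub>6\<^sup>2)\<close>.\<close>

lemma diagonal_form_estimate:
  fixes A B C x0 x3 x5 x6 :: real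
  assumes A: "1 \<le> A" and B: "1 \<le> B" and C: "1 \<le> C"
    and x0: "0 \<le> x0" "x0 \<le> x5" and x3: "0 \<le> x3" "x3 \<le> x5" and x6: "x5 \<le> x6"
  shows "x0\<^sup>2 + A * B * x3\<^sup>2 + A * C * x5\<^sup>2 + B * C * x6\<^sup>2 \<le> A * B * C * (x5 + x6)\<^sup>2"
proof -
  have AB: "1 \<le> A * B"
    using mult_mono[of 1 A 1 B] A B by simp
  have ABC: "1 \<le> A * B * C" "A * B \<le> A * B * C"
    using mult_mono[of 1 "A * B" 1 C] mult_left_mono[of 1 C "A * B"] AB C by simp_all
  have AC: "A * C \<le> A * B * C"
    using mult_left_mono[of 1 B "A * C"] A B C by (simp add: algebra_simps)
  have BC: "B * C \<le> A * B * C"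
    using mult_right_mono[of 1 A "B * C"] A B C by (simp add: algebra_simps)
  have "x0\<^sup>2 \<le> A * B * C * x5\<^sup>2"
    using mult_mono[of 1 "A * B * C" "x0\<^sup>2" "x5\<^sup>2"] ABC x0 by (simp add: power_mono)
  moreover have "A * B * x3\<^sup>2 \<le> A * B * C * x5\<^sup>2"
    using mult_mono[of "A * B" "A * B * C" "x3\<^sup>2" "x5\<^sup>2"] ABC x3 by (simp add: power_mono)
  moreover have "A * C * x5\<^sup>2 \<le> A * B * C * x5\<^sup>2"
    using AC by (rule mult_right_mono) simp
  moreover have "B * C * x6\<^sup>2 \<le> A * B * C * x6\<^sup>2"
    using BC by (rule mult_right_mono) simp
  ultimately have "x0\<^sup>2 + A * B * x3\<^sup>2 + A * C * x5\<^sup>2 + B * C * x6\<^sup>2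
      \<le> A * B * C * (3 * x5\<^sup>2 + x6\<^sup>2)"
    by (simp add: algebra_simps)
  also have "\<dots> \<le> A * B * C * (x5 + x6)\<^sup>2"
  proof (rule mult_left_mono)
    show "3 * x5\<^sup>2 + x6\<^sup>2 \<le> (x5 + x6)\<^sup>2"
      using mult_left_mono[OF x6, of x5] x0 by (simp add: power2_eq_square algebra_simps)
    show "0 \<le> A * B * C"
      using ABC by linarith
  qed
  finally show ?thesis .
qed

lemma oct_norm_fib_oct_neg:
  assumes "\<alpha> \<le> -1" "\<beta> \<le> -1" "\<gamma> \<le> -1"
  shows "oct_norm \<alpha> \<beta> \<gamma> (fib_oct n) < 0"
proof -
  define x where "x k = real (fib (n + k))" for k
  have coord: "fib_oct n $ 0 = x 0" "fib_oct n $ 1 = x 1" "fib_oct n $ 2 = x 2"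
    "fib_oct n $ 3 = x 3" "fib_oct n $ 4 = x 4" "fib_oct n $ 5 = x 5"
    "fib_oct n $ 6 = x 6" "fib_oct n $ 7 = x 7"
    using fib_oct_nth[of 0 n] fib_oct_nth[of 1 n] fib_oct_nth[of 2 n] fib_oct_nth[of 3 n]
      fib_oct_nth[of 4 n] fib_oct_nth[of 5 n] fib_oct_nth[of 6 n] fib_oct_nth[of 7 n]
    by (simp_all add: x_def)
  have mono: "x i \<le> x j" if "i \<le> j" for i j
    using that by (simp add: x_def fib_mono)
  have x7: "x 7 = x 5 + x 6"
    by (simp add: x_def numeral_eq_Suc)
  \<comment> \<open>Coordinate \<open>1\<close> rather than \<open>0\<close>, because \<open>fib 0 = 0\<close>.\<close>
  have x1: "0 < x 1"
    by (simp add: x_def fib_neq_0_nat)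
  have "(x 0)\<^sup>2 + \<alpha> * \<beta> * (x 3)\<^sup>2 + \<alpha> * \<gamma> * (x 5)\<^sup>2 + \<beta> * \<gamma> * (x 6)\<^sup>2
      \<le> - (\<alpha> * \<beta> * \<gamma> * (x 7)\<^sup>2)"
    using diagonal_form_estimate[of "- \<alpha>" "- \<beta>" "- \<gamma>" "x 0" "x 5" "x 3" "x 6"] assms x7
    by (simp add: mono) (simp add: x_def)
  moreover have "\<alpha> * (x 1)\<^sup>2 < 0"
    using assms x1 by (simp add: mult_neg_pos)
  moreover have "\<beta> * (x 2)\<^sup>2 \<le> 0" "\<gamma> * (x 4)\<^sup>2 \<le> 0"
    using assms by (auto intro: mult_nonpos_nonneg)
  ultimately show ?thesis
    unfolding oct_norm_def coord by linarith
qed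

theorem proposition3p4:
  fixes a :: real
  assumes "a \<le> -2"
  shows "\<forall>n::nat. oct_invertible (a + 1) (2 * a + 1) (3 * a + 1) (fib_oct n)"
proof
  fix n
  have "oct_norm (a + 1) (2 * a + 1) (3 * a + 1) (fib_oct n) < 0"
    using assms by (intro oct_norm_fib_oct_neg) auto
  then show "oct_invertible (a + 1) (2 * a + 1) (3 * a + 1) (fib_oct n)"
    by (intro oct_invertible_if_norm_nonzero) simp
qed

end
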